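(* Let $c>1$ be a constant. Given a set $P$ of $n$ points in $d$-dimensional Hamming space $\{0,1\}^d$, a positive integer $k\le n$ and block size $B$, there exists an indexing scheme using $O(n^{O(1)}d\lceil k/B\rceil)$ blocks of space such that for every query $q\in\{0,1\}^d$, some $\lceil k/B\rceil$ blocks together contain $k$ points of $P$ each at Hamming distance at most $c$ times the distance from $q$ to its $k$-th nearest neighbor in $P$.
   Context: Indexing scheme (indexability model): for a point set $P$ and block size $B$, a collection $\mathcal{B}$ of blocks, each a subset of $P$ of at most $B$ points; its space usage is $|\mathcal{B}|$; the query time for a query $q$ is the minimum number of blocks whose union contains a valid answer, the blocks being identified for free. *)

theory Defs
  imports Complex_Main "HOL-Library.Multiset"
begin

definition hamming_space :: "nat \<Rightarrow> bool list set" where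
  "hamming_space d = {x. length x = d}"

definition hamming_dist :: "bool list \<Rightarrow> bool list \<Rightarrow> nat" where
  "hamming_dist x y = card {i. i < length x \<and> x ! i \<noteq> y ! i}"

text \<open>The distances from \<open>q\<close> to the points of \<open>P\<close> are sorted with multiplicity,
  so ties between equidistant points are counted; meaningful for \<open>1 \<le> k \<le> card P\<close>.\<close>

definition kth_nn_dist :: "bool list set \<Rightarrow> nat \<Rightarrow> bool list \<Rightarrow> nat" where
  "kth_nn_dist P k q =
     sorted_list_of_multiset (image_mset (hamming_dist q) (mset_set P)) ! (k - 1)"

definition approx_knn_answer ::
    "real \<Rightarrow> bool list set \<Rightarrow> nat \<Rightarrow> bool list \<Rightarrow> bool list set \<Rightarrow> bool" where
  "approx_knn_answer c P k q A \<longleftrightarrow>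
     A \<subseteq> P \<and> card A = k \<and>
     (\<forall>p\<in>A. real (hamming_dist q p) \<le> c * real (kth_nn_dist P k q))"

definition indexing_scheme :: "'a set \<Rightarrow> nat \<Rightarrow> 'a set set \<Rightarrow> bool" where
  "indexing_scheme P B \<B> \<longleftrightarrow>
     finite \<B> \<and> (\<forall>b\<in>\<B>. b \<subseteq> P \<and> finite b \<and> card b \<le> B)"

end

theory Submission imports Defs begin

text \<open>
  Fix a query \<open>q\<close>, let \<open>r\<close> be its \<open>k\<close>-th nearest neighbor distance and let \<open>p\<close> be a point of
  \<open>P\<close> within distance \<open>r\<close> of \<open>q\<close>. Regarding points as real vectors, we have
  \<open>dist q x = |q - p|\<^sup>2 + |x - p|\<^sup>2 - 2 \<langle>q - p, x - p\<rangle>\<close>, so the points within distance \<open>2 r\<close> of \<open>p\<close>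
  are ranked up to an error \<open>O(\<eta> r)\<close> by any vector \<open>g\<close> whose inner products with the \<open>x - p\<close> agree
  with those of \<open>q - p\<close> up to \<open>2 \<eta> r\<close>. Such a \<open>g\<close> is found greedily: as long as some \<open>x - p\<close>
  witnesses a larger error, add \<open>\<plusminus>\<eta> (x - p)\<close> to \<open>g\<close>. Each step lowers \<open>|q - p - g|\<^sup>2 \<le> r\<close> by at
  least \<open>2 \<eta>\<^sup>2 r\<close>, so there are at most \<open>1 / (2 \<eta>\<^sup>2)\<close> steps. Hence \<open>g\<close>, and with it a valid
  answer, is determined by a bounded number of points of \<open>P\<close>, and polynomially many answers
  suffice for all queries.
\<close>

subsection \<open>Greedy approximation of inner products\<close>

definition inner_on :: "'i set \<Rightarrow> ('i \<Rightarrow> real) \<Rightarrow> ('i \<Rightarrow> real) \<Rightarrow> real" where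
  "inner_on I u v = (\<Sum>i\<in>I. u i * v i)"

lemma inner_on_self_nonneg: "0 \<le> inner_on I u u"
  by (simp add: inner_on_def sum_nonneg)

lemma inner_on_eq_0_if_self_le_0:
  assumes "finite I" "inner_on I u u \<le> 0"
  shows "inner_on I u v = 0"
proof -
  have "inner_on I u u = 0"
    using assms(2) inner_on_self_nonneg by (rule order_antisym)
  then have "\<forall>i\<in>I. u i = 0"
    using assms(1) by (simp add: inner_on_def sum_nonneg_eq_0_iff)
  then show ?thesis
    by (simp add: inner_on_def)
qed

lemma inner_on_diff_scaled_self:
  "inner_on I (\<lambda>i. u i - t * x i) (\<lambda>i. u i - t * x i) =
    inner_on I u u - 2 * (t * inner_on I u x) + t\<^sup>2 * inner_on I x x"
  by (simp add: inner_on_def power2_eq_square algebra_simps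
      sum.distrib sum_subtractf sum_distrib_left)

primrec sparse_sums :: "real \<Rightarrow> ('i \<Rightarrow> real) set \<Rightarrow> nat \<Rightarrow> ('i \<Rightarrow> real) set" where
  "sparse_sums \<eta> X 0 = {\<lambda>_. 0}"
| "sparse_sums \<eta> X (Suc m) =
    (\<lambda>(t, x, g). \<lambda>i. t * x i + g i) ` ({-\<eta>, 0, \<eta>} \<times> X \<times> sparse_sums \<eta> X m)"

lemma sparse_sums_SucI:
  assumes "t \<in> {-\<eta>, 0, \<eta>}" "x \<in> X" "g \<in> sparse_sums \<eta> X m"
  shows "(\<lambda>i. t * x i + g i) \<in> sparse_sums \<eta> X (Suc m)"
  unfolding sparse_sums.simps using assms by (intro image_eqI[of _ _ "(t, x, g)"]) simp_all

lemma zero_in_sparse_sums: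
  assumes "X \<noteq> {}"
  shows "(\<lambda>_. 0) \<in> sparse_sums \<eta> X m"
proof (induction m)
  case (Suc m)
  obtain x where "x \<in> X"
    using assms by blast
  then show ?case
    using sparse_sums_SucI[of 0 \<eta> x X, OF _ _ Suc.IH] by simp
qed simp

lemma finite_sparse_sums: "finite X \<Longrightarrow> finite (sparse_sums \<eta> X m)"
  by (induction m) auto

lemma card_sparse_sums_le:
  assumes "finite X"
  shows "card (sparse_sums \<eta> X m) \<le> (3 * card X) ^ m"
proof (induction m)
  case (Suc m)
  have "card (sparse_sums \<eta> X (Suc m)) \<le> card ({-\<eta>, 0, \<eta>} \<times> X \<times> sparse_sums \<eta> X m)"
    unfolding sparse_sums.simps using assms
    by (intro card_image_le) (simp add: finite_sparse_sums)
  also have "\<dots> = card {-\<eta>, 0, \<eta>} * (card X * card (sparse_sums \<eta> X m))"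
    by (simp add: card_cartesian_product)
  also have "\<dots> \<le> 3 * (card X * (3 * card X) ^ m)"
    using Suc.IH by (intro mult_le_mono) (simp_all add: card_insert_if)
  finally show ?case
    by simp
qed simp

lemma exists_step_decreasing_self_inner:
  assumes "0 \<le> \<eta>" "inner_on I x x \<le> s" "\<eta> * s \<le> \<bar>inner_on I u x\<bar>"
  obtains t where "t \<in> {-\<eta>, 0, \<eta>}"
    "inner_on I (\<lambda>i. u i - t * x i) (\<lambda>i. u i - t * x i) \<le> inner_on I u u - \<eta>\<^sup>2 * s"
proof -
  define t where "t = (if 0 < inner_on I u x then \<eta> else -\<eta>)"
  have "\<eta> * (\<eta> * s) \<le> \<eta> * \<bar>inner_on I u x\<bar>"
    using assms(1,3) by (intro mult_left_mono)
  also have "\<dots> = t * inner_on I u x"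
    by (simp add: t_def)
  finally have gain: "\<eta>\<^sup>2 * s \<le> t * inner_on I u x"
    by (simp add: power2_eq_square mult_ac)
  have cost: "t\<^sup>2 * inner_on I x x \<le> \<eta>\<^sup>2 * s"
    using assms(2) by (simp add: t_def mult_left_mono)
  have "inner_on I (\<lambda>i. u i - t * x i) (\<lambda>i. u i - t * x i) \<le> inner_on I u u - \<eta>\<^sup>2 * s"
    unfolding inner_on_diff_scaled_self using gain cost by linarith
  then show thesis
    by (intro that[of t]) (simp_all add: t_def)
qed

lemma sparse_sum_approximates_inner:
  assumes I: "finite I" and X: "X \<noteq> {}" "\<And>x. x \<in> X \<Longrightarrow> inner_on I x x \<le> s"
    and \<eta>: "0 \<le> \<eta>" and u: "inner_on I u u \<le> real m * (\<eta>\<^sup>2 * s)"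
  shows "\<exists>g\<in>sparse_sums \<eta> X m. \<forall>x\<in>X. \<bar>inner_on I (\<lambda>i. u i - g i) x\<bar> \<le> \<eta> * s"
  using u
proof (induction m arbitrary: u)
  case 0
  have "0 \<le> s"
    using X inner_on_self_nonneg by (meson ex_in_conv order_trans)
  then show ?case
    using 0 \<eta> inner_on_eq_0_if_self_le_0[OF I] by simp
next
  case (Suc m)
  show ?case
  proof (cases "\<forall>x\<in>X. \<bar>inner_on I u x\<bar> \<le> \<eta> * s")
    case True
    then show ?thesis
      by (intro bexI[OF _ zero_in_sparse_sums[OF X(1)]]) simp
  next
    case False
    then obtain x where x: "x \<in> X" and "\<eta> * s \<le> \<bar>inner_on I u x\<bar>"
      by force
    then obtain t where t: "t \<in> {-\<eta>, 0, \<eta>}" and decrease: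
      "inner_on I (\<lambda>i. u i - t * x i) (\<lambda>i. u i - t * x i) \<le> inner_on I u u - \<eta>\<^sup>2 * s"
      using exists_step_decreasing_self_inner[OF \<eta> X(2)[OF x]] by blast
    have "inner_on I u u \<le> real m * (\<eta>\<^sup>2 * s) + \<eta>\<^sup>2 * s"
      using Suc.prems by (simp add: distrib_right)
    then have "inner_on I (\<lambda>i. u i - t * x i) (\<lambda>i. u i - t * x i) \<le> real m * (\<eta>\<^sup>2 * s)"
      using decrease by linarith
    then obtain g where g: "g \<in> sparse_sums \<eta> X m"
      and "\<forall>y\<in>X. \<bar>inner_on I (\<lambda>i. u i - t * x i - g i) y\<bar> \<le> \<eta> * s"
      using Suc.IH by blast
    then show ?thesis
      by (intro bexI[OF _ sparse_sums_SucI[OF t x g]]) (simp add: diff_diff_eq)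
  qed
qed

subsection \<open>From families of answers to indexing schemes\<close>

lemma partition_into_small_sets:
  assumes "finite A" "m \<le> card A" "card A \<le> m * B" "1 \<le> B"
  shows "\<exists>S. finite S \<and> card S = m \<and> \<Union>S = A \<and> (\<forall>b\<in>S. card b \<le> B)"
  using assms
proof (induction m arbitrary: A)
  case 0
  then show ?case
    by (intro exI[of _ "{}"]) auto
next
  case (Suc m)
  define l where "l = min (card A - 1) (m * B)"
  have l_bounds: "m \<le> l" "l \<le> m * B" "l < card A" "card A - l \<le> B"
    using Suc.prems by (auto simp: l_def min_def)
  obtain A' where A': "A' \<subseteq> A" "card A' = l" "finite A'"
    using obtain_subset_with_card_n[of l A] l_bounds(3) by (metis less_imp_le)
  then obtain S where S: "finite S" "card S = m" "\<Union>S = A'" "\<forall>b\<in>S. card b \<le> B"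
    using Suc.IH[of A'] l_bounds Suc.prems(4) by auto
  have card_rest: "card (A - A') = card A - l"
    using A' by (simp add: card_Diff_subset)
  then have "A - A' \<noteq> {}"
    using l_bounds(3) by (metis card.empty zero_less_diff less_irrefl)
  then have "A - A' \<notin> S"
    using S(3) by auto
  then show ?case
    using S A'(1) card_rest l_bounds(4) by (intro exI[of _ "insert (A - A') S"]) auto
qed

lemma partition_into_ceiling_many_small_sets:
  assumes "finite A" "1 \<le> B"
  shows "\<exists>S. finite S \<and> int (card S) = \<lceil>real (card A) / real B\<rceil> \<and> \<Union>S = A \<and> (\<forall>b\<in>S. card b \<le> B)"
proof -
  define t where "t = nat \<lceil>real (card A) / real B\<rceil>"
  have "(0::real) \<le> real (card A) / real B"
    by simp
  then have int_t: "int t = \<lceil>real (card A) / real B\<rceil>"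
    unfolding t_def by linarith
  have "real (card A) / real B \<le> real (card A)"
    using assms(2) by (simp add: divide_le_eq mult_le_cancel_left1)
  then have "t \<le> card A"
    by (simp add: t_def ceiling_le_iff)
  moreover have "real (card A) / real B \<le> real t"
    unfolding t_def by (rule of_nat_ceiling)
  then have "real (card A) \<le> real (t * B)"
    using assms(2) by (simp add: field_simps)
  then have "card A \<le> t * B"
    by (simp only: of_nat_le_iff)
  ultimately show ?thesis
    using partition_into_small_sets[OF assms(1) _ _ assms(2)] int_t by metis
qed

lemma indexing_scheme_covering_family:
  assumes "finite \<A>" and \<A>: "\<And>A. A \<in> \<A> \<Longrightarrow> A \<subseteq> P \<and> finite A \<and> card A = k" and "1 \<le> B"
  shows "\<exists>\<B>. indexing_scheme P B \<B> \<and> real (card \<B>) \<le> real (card \<A>) * \<lceil>real k / real B\<rceil> \<and>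
    (\<forall>A\<in>\<A>. \<exists>\<S>\<subseteq>\<B>. int (card \<S>) = \<lceil>real k / real B\<rceil> \<and> A \<subseteq> \<Union>\<S>)"
proof -
  have "\<forall>A\<in>\<A>. \<exists>S. finite S \<and> int (card S) = \<lceil>real k / real B\<rceil> \<and> \<Union>S = A \<and> (\<forall>b\<in>S. card b \<le> B)"
    using \<A> partition_into_ceiling_many_small_sets[OF _ assms(3)] by metis
  then obtain S where S: "\<And>A. A \<in> \<A> \<Longrightarrow> finite (S A) \<and> int (card (S A)) = \<lceil>real k / real B\<rceil> \<and>
      \<Union>(S A) = A \<and> (\<forall>b\<in>S A. card b \<le> B)"
    by metis
  define \<B> where "\<B> = (\<Union>A\<in>\<A>. S A)"
  have "b \<subseteq> P \<and> finite b \<and> card b \<le> B" if b: "b \<in> \<B>" for b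
  proof -
    obtain A where A: "A \<in> \<A>" "b \<in> S A"
      using b unfolding \<B>_def by blast
    then have "b \<subseteq> A" "card b \<le> B"
      using S[OF A(1)] by auto
    then show ?thesis
      using \<A>[OF A(1)] by (meson finite_subset order_trans)
  qed
  then have "indexing_scheme P B \<B>"
    using assms(1) S by (simp add: indexing_scheme_def \<B>_def)
  moreover have "real (card \<B>) \<le> real (card \<A>) * \<lceil>real k / real B\<rceil>"
  proof -
    have card_S: "real (card (S A)) = \<lceil>real k / real B\<rceil>" if "A \<in> \<A>" for A
      using S[OF that] by (metis of_int_of_nat_eq)
    have "real (card \<B>) \<le> real (\<Sum>A\<in>\<A>. card (S A))"
      unfolding \<B>_def by (intro of_nat_mono card_UN_le assms(1))
    also have "\<dots> = real (card \<A>) * \<lceil>real k / real B\<rceil>"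
      by (simp add: card_S)
    finally show ?thesis .
  qed
  moreover have "\<exists>\<S>\<subseteq>\<B>. int (card \<S>) = \<lceil>real k / real B\<rceil> \<and> A \<subseteq> \<Union>\<S>" if "A \<in> \<A>" for A
    using that S by (intro exI[of _ "S A"]) (auto simp: \<B>_def)
  ultimately show ?thesis
    by blast
qed

lemma refine_family_to_card_subsets:
  assumes "finite \<C>"
  shows "\<exists>\<A>. finite \<A> \<and> card \<A> \<le> card \<C> \<and> (\<forall>A\<in>\<A>. card A = k \<and> (\<exists>C\<in>\<C>. A \<subseteq> C)) \<and>
    (\<forall>C\<in>\<C>. k \<le> card C \<longrightarrow> (\<exists>A\<in>\<A>. A \<subseteq> C))"
proof -
  define \<C>' where "\<C>' = {C\<in>\<C>. k \<le> card C}"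
  have "\<forall>C\<in>\<C>'. \<exists>A. A \<subseteq> C \<and> card A = k"
    unfolding \<C>'_def by (metis (lifting) mem_Collect_eq obtain_subset_with_card_n)
  then obtain pick where pick: "\<And>C. C \<in> \<C>' \<Longrightarrow> pick C \<subseteq> C \<and> card (pick C) = k"
    by metis
  have "\<C>' \<subseteq> \<C>" and fin: "finite \<C>'"
    using assms by (auto simp: \<C>'_def)
  then have "card (pick ` \<C>') \<le> card \<C>"
    using assms by (meson card_image_le card_mono order_trans)
  then show ?thesis
    using fin pick by (intro exI[of _ "pick ` \<C>'"]) (auto simp: \<C>'_def)
qed

subsection \<open>Hamming space\<close>

lemma hamming_dist_commute: "length x = length y \<Longrightarrow> hamming_dist x y = hamming_dist y x"
  by (simp add: hamming_dist_def eq_commute)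

lemma hamming_dist_triangle:
  assumes "length x = length y"
  shows "hamming_dist x z \<le> hamming_dist x y + hamming_dist y z"
proof -
  have "{i. i < length x \<and> x ! i \<noteq> z ! i}
      \<subseteq> {i. i < length x \<and> x ! i \<noteq> y ! i} \<union> {i. i < length y \<and> y ! i \<noteq> z ! i}"
    using assms by auto
  then show ?thesis
    unfolding hamming_dist_def
    by (intro order_trans[OF card_mono card_Un_le]) auto
qed

definition displacement :: "bool list \<Rightarrow> bool list \<Rightarrow> nat \<Rightarrow> real" where
  "displacement p x i = of_bool (x ! i) - of_bool (p ! i)"

lemma hamming_dist_eq_inner_on_displacement:
  assumes "length p = d"
  shows "real (hamming_dist p x) = inner_on {..<d} (displacement p x) (displacement p x)"
proof -
  have "inner_on {..<d} (displacement p x) (displacement p x)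
      = (\<Sum>i<d. if p ! i \<noteq> x ! i then 1 else 0)"
    unfolding inner_on_def displacement_def by (intro sum.cong) auto
  also have "\<dots> = real (card {i\<in>{..<d}. p ! i \<noteq> x ! i})"
    by (simp flip: sum.inter_filter)
  finally show ?thesis
    using assms by (simp add: hamming_dist_def)
qed

lemma hamming_dist_via_base_point:
  assumes "length q = d" "length p = d"
  shows "real (hamming_dist q x) = real (hamming_dist q p) + real (hamming_dist p x)
    - 2 * inner_on {..<d} (displacement p q) (displacement p x)"
  unfolding hamming_dist_eq_inner_on_displacement[OF assms(1)]
    hamming_dist_eq_inner_on_displacement[OF assms(2)] inner_on_def displacement_def
    sum_distrib_left sum.distrib[symmetric] sum_subtractf[symmetric]
  by (intro sum.cong) (simp_all add: algebra_simps)

lemma sorted_length_filter_le_nth: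
  assumes "sorted xs" "1 \<le> k" "k \<le> length xs"
  shows "k \<le> length (filter (\<lambda>x. x \<le> xs ! (k - 1)) xs)"
proof -
  have "{..<k} \<subseteq> {i. i < length xs \<and> xs ! i \<le> xs ! (k - 1)}"
    using assms by (auto intro!: sorted_nth_mono)
  then have "card {..<k} \<le> card {i. i < length xs \<and> xs ! i \<le> xs ! (k - 1)}"
    by (intro card_mono) simp_all
  then show ?thesis
    by (simp add: length_filter_conv_card)
qed

lemma card_within_kth_nn_dist:
  assumes "finite P" "1 \<le> k" "k \<le> card P"
  shows "k \<le> card {x\<in>P. hamming_dist q x \<le> kth_nn_dist P k q}"
proof -
  define M where "M = image_mset (hamming_dist q) (mset_set P)"
  define xs where "xs = sorted_list_of_multiset M"
  have mset_xs: "mset xs = M"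
    by (simp add: xs_def)
  have kth: "kth_nn_dist P k q = xs ! (k - 1)"
    by (simp add: kth_nn_dist_def xs_def M_def)
  have "length xs = size M"
    unfolding mset_xs[symmetric] by simp
  then have "length xs = card P"
    by (simp add: M_def)
  then have "k \<le> length (filter (\<lambda>x. x \<le> kth_nn_dist P k q) xs)"
    unfolding kth using assms by (intro sorted_length_filter_le_nth) (simp_all add: xs_def)
  also have "\<dots> = size (filter_mset (\<lambda>x. x \<le> kth_nn_dist P k q) M)"
    by (metis mset_filter mset_xs size_mset)
  also have "\<dots> = card {x\<in>P. hamming_dist q x \<le> kth_nn_dist P k q}"
    using assms by (simp add: M_def filter_mset_image_mset)
  finally show ?thesis .
qed

subsection \<open>Candidate sets\<close>

text \<open>
  The vector \<open>g\<close> stands in for \<open>q - p\<close>, and the summand \<open>|q - p|\<^sup>2\<close> of \<open>dist q x\<close> is left out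
  because it is the same for all \<open>x\<close>.
\<close>

definition score :: "nat \<Rightarrow> bool list \<Rightarrow> (nat \<Rightarrow> real) \<Rightarrow> bool list \<Rightarrow> real" where
  "score d p g x = real (hamming_dist p x) - 2 * inner_on {..<d} g (displacement p x)"

lemma hamming_dist_minus_score:
  assumes "length q = d" "length p = d"
  shows "real (hamming_dist q x) - score d p g x = real (hamming_dist q p)
    - 2 * inner_on {..<d} (\<lambda>i. displacement p q i - g i) (displacement p x)"
  using hamming_dist_via_base_point[OF assms, of x]
  by (simp add: score_def inner_on_def left_diff_distrib sum_subtractf)

text \<open>
  The radius of the neighborhood of \<open>p\<close> and the score threshold are given by points \<open>y\<close> and \<open>z\<close>
  of \<open>P\<close>, which leaves only polynomially many candidate sets.
\<close>

definition neighborhood :: "bool list set \<Rightarrow> bool list \<Rightarrow> bool list \<Rightarrow> bool list set" where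
  "neighborhood P p y = {x\<in>P. hamming_dist p x \<le> hamming_dist p y}"

definition candidates ::
    "nat \<Rightarrow> bool list set \<Rightarrow> bool list \<Rightarrow> bool list \<Rightarrow> bool list \<Rightarrow> (nat \<Rightarrow> real) \<Rightarrow> bool list set" where
  "candidates d P p y z g = {x\<in>neighborhood P p y. score d p g x \<le> score d p g z}"

definition candidate_sets :: "real \<Rightarrow> nat \<Rightarrow> nat \<Rightarrow> bool list set \<Rightarrow> bool list set set" where
  "candidate_sets \<eta> m d P = (\<Union>p\<in>P. \<Union>y\<in>P. \<Union>z\<in>P.
    candidates d P p y z ` sparse_sums \<eta> (displacement p ` neighborhood P p y) m)"

lemma finite_neighborhood: "finite P \<Longrightarrow> finite (neighborhood P p y)"
  by (simp add: neighborhood_def)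

lemma candidate_sets_subset: "C \<in> candidate_sets \<eta> m d P \<Longrightarrow> C \<subseteq> P"
  by (auto simp: candidate_sets_def candidates_def neighborhood_def)

lemma finite_candidate_sets: "finite P \<Longrightarrow> finite (candidate_sets \<eta> m d P)"
  by (simp add: candidate_sets_def finite_sparse_sums finite_neighborhood)

lemma card_UN_le_mult:
  assumes "finite I" "\<And>i. i \<in> I \<Longrightarrow> card (A i) \<le> b"
  shows "card (\<Union>i\<in>I. A i) \<le> card I * b"
  using card_UN_le[OF assms(1), of A] sum_bounded_above[of I "\<lambda>i. card (A i)" b] assms(2) by simp

lemma card_candidate_sets_le:
  assumes "finite P"
  shows "card (candidate_sets \<eta> m d P) \<le> 3 ^ m * card P ^ (m + 3)"
proof -
  have "card (candidates d P p y z ` sparse_sums \<eta> (displacement p ` neighborhood P p y) m)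
      \<le> (3 * card P) ^ m" for p y z
  proof -
    define V where "V = displacement p ` neighborhood P p y"
    have finV: "finite V"
      using assms by (simp add: V_def finite_neighborhood)
    have "card V \<le> card (neighborhood P p y)"
      unfolding V_def using assms by (intro card_image_le finite_neighborhood)
    also have "\<dots> \<le> card P"
      using assms by (auto simp: neighborhood_def intro: card_mono)
    finally have "(3 * card V) ^ m \<le> (3 * card P) ^ m"
      by (simp add: power_mono)
    moreover have "card (candidates d P p y z ` sparse_sums \<eta> V m) \<le> card (sparse_sums \<eta> V m)"
      using finV by (intro card_image_le finite_sparse_sums)
    ultimately show ?thesis
      using card_sparse_sums_le[OF finV, of \<eta> m] unfolding V_def[symmetric] by linarith
  qed
  then have "card (candidate_sets \<eta> m d P) \<le> card P * (card P * (card P * (3 * card P) ^ m))"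
    unfolding candidate_sets_def using assms by (intro card_UN_le_mult)
  also have "\<dots> = 3 ^ m * card P ^ (m + 3)"
    by (simp add: power_add power_mult_distrib power3_eq_cube mult_ac)
  finally show ?thesis .
qed

lemma hamming_dist_candidates_le:
  assumes len: "length q = d" "length p = d"
    and approx: "\<And>x. x \<in> neighborhood P p y \<Longrightarrow>
      \<bar>inner_on {..<d} (\<lambda>i. displacement p q i - g i) (displacement p x)\<bar> \<le> \<epsilon>"
    and z: "z \<in> neighborhood P p y" and x: "x \<in> candidates d P p y z g"
  shows "real (hamming_dist q x) \<le> real (hamming_dist q z) + 4 * \<epsilon>"
proof -
  have "x \<in> neighborhood P p y" and "score d p g x \<le> score d p g z"
    using x by (simp_all add: candidates_def)
  then show ?thesis
    using approx[of x] approx[OF z] hamming_dist_minus_score[OF len, of x g]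
      hamming_dist_minus_score[OF len, of z g] by linarith
qed

lemma sparse_sum_approximates_displacement:
  assumes \<eta>: "0 \<le> \<eta>" "1 \<le> 2 * real m * \<eta>\<^sup>2" and "length p = d" "X \<noteq> {}"
    and "hamming_dist p q \<le> r" "\<And>x. x \<in> X \<Longrightarrow> hamming_dist p x \<le> 2 * r"
  shows "\<exists>g\<in>sparse_sums \<eta> (displacement p ` X) m. \<forall>x\<in>X.
    \<bar>inner_on {..<d} (\<lambda>i. displacement p q i - g i) (displacement p x)\<bar> \<le> \<eta> * (2 * real r)"
proof -
  note self_inner = hamming_dist_eq_inner_on_displacement[OF assms(3), symmetric]
  have "real (hamming_dist p x) \<le> 2 * real r" if "x \<in> X" for x
    using assms(6)[OF that] by simp
  then have "inner_on {..<d} v v \<le> 2 * real r" if "v \<in> displacement p ` X" for v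
    using that by (auto simp: self_inner)
  moreover have "inner_on {..<d} (displacement p q) (displacement p q)
      \<le> real m * (\<eta>\<^sup>2 * (2 * real r))"
  proof -
    have "real (hamming_dist p q) \<le> 1 * real r"
      using assms(5) by simp
    also have "\<dots> \<le> (2 * real m * \<eta>\<^sup>2) * real r"
      using \<eta>(2) by (rule mult_right_mono) simp
    finally show ?thesis
      by (simp add: self_inner mult_ac)
  qed
  ultimately show ?thesis
    using sparse_sum_approximates_inner[of "{..<d}" "displacement p ` X" "2 * real r" \<eta>
        "displacement p q" m] assms(4) \<eta>(1) by simp
qed

lemma exists_candidate_set_superset:
  assumes \<eta>: "0 \<le> \<eta>" "1 \<le> 2 * real m * \<eta>\<^sup>2"
    and P: "P \<subseteq> hamming_space d" and q: "q \<in> hamming_space d"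
    and N: "N \<subseteq> P" "finite N" "N \<noteq> {}" and near: "\<And>x. x \<in> N \<Longrightarrow> hamming_dist q x \<le> r"
  shows "\<exists>C\<in>candidate_sets \<eta> m d P. N \<subseteq> C \<and>
    (\<forall>x\<in>C. real (hamming_dist q x) \<le> (1 + 8 * \<eta>) * real r)"
proof -
  obtain p where p: "p \<in> N"
    using N(3) by blast
  have len: "length q = d" "length p = d"
    using q p N(1) P by (auto simp: hamming_space_def)
  then have dist_pq: "hamming_dist p q \<le> r"
    using near[OF p] by (simp add: hamming_dist_commute)
  obtain y where y: "y \<in> N" and farthest: "hamming_dist p y = Max (hamming_dist p ` N)"
    using obtains_MAX[OF N(2,3), of "hamming_dist p"] by metis
  define X where "X = neighborhood P p y"
  have NX: "N \<subseteq> X"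
    using N(1,2) by (auto simp: X_def neighborhood_def farthest)
  have "hamming_dist p y \<le> 2 * r"
    using hamming_dist_triangle[of p q y] dist_pq near[OF y] len by simp
  then have "hamming_dist p x \<le> 2 * r" if "x \<in> X" for x
    using that by (simp add: X_def neighborhood_def)
  then obtain g where g: "g \<in> sparse_sums \<eta> (displacement p ` X) m"
    and approx: "\<And>x. x \<in> X \<Longrightarrow>
      \<bar>inner_on {..<d} (\<lambda>i. displacement p q i - g i) (displacement p x)\<bar> \<le> \<eta> * (2 * real r)"
    using sparse_sum_approximates_displacement[OF \<eta> len(2) _ dist_pq, of X] NX p by blast
  obtain z where z: "z \<in> N" and top_score: "score d p g z = Max (score d p g ` N)"
    using obtains_MAX[OF N(2,3), of "score d p g"] by metis
  have "candidates d P p y z g \<in> candidate_sets \<eta> m d P"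
    using p y z N(1) g unfolding candidate_sets_def X_def by blast
  moreover have "N \<subseteq> candidates d P p y z g"
    using NX N(2) by (auto simp: candidates_def X_def top_score)
  moreover have "real (hamming_dist q x) \<le> (1 + 8 * \<eta>) * real r"
    if "x \<in> candidates d P p y z g" for x
  proof -
    have "real (hamming_dist q x) \<le> real (hamming_dist q z) + 4 * (\<eta> * (2 * real r))"
      using hamming_dist_candidates_le[OF len _ _ that] approx z NX unfolding X_def by blast
    also have "\<dots> \<le> (1 + 8 * \<eta>) * real r"
      using near[OF z] by (simp add: algebra_simps)
    finally show ?thesis .
  qed
  ultimately show ?thesis
    by blast
qed

lemma exists_large_candidate_set_near_query:
  assumes "0 \<le> \<eta>" "1 \<le> 2 * real m * \<eta>\<^sup>2"
    and "P \<subseteq> hamming_space d" "finite P" "1 \<le> k" "k \<le> card P" "q \<in> hamming_space d"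
  shows "\<exists>C\<in>candidate_sets \<eta> m d P. k \<le> card C \<and>
    (\<forall>x\<in>C. real (hamming_dist q x) \<le> (1 + 8 * \<eta>) * real (kth_nn_dist P k q))"
proof -
  define N where "N = {x\<in>P. hamming_dist q x \<le> kth_nn_dist P k q}"
  have card_N: "k \<le> card N"
    unfolding N_def using assms by (intro card_within_kth_nn_dist)
  then have "N \<noteq> {}"
    using assms(5) by auto
  moreover have "N \<subseteq> P" "finite N" "\<And>x. x \<in> N \<Longrightarrow> hamming_dist q x \<le> kth_nn_dist P k q"
    using assms(4) by (auto simp: N_def)
  ultimately obtain C where C: "C \<in> candidate_sets \<eta> m d P" "N \<subseteq> C"
    "\<forall>x\<in>C. real (hamming_dist q x) \<le> (1 + 8 * \<eta>) * real (kth_nn_dist P k q)"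
    using exists_candidate_set_superset[OF assms(1,2,3,7)] by metis
  have "finite C"
    using candidate_sets_subset[OF C(1)] assms(4) by (rule finite_subset)
  then have "k \<le> card C"
    using card_N card_mono[OF _ C(2)] by linarith
  with C show ?thesis
    by blast
qed

lemma approx_knn_answer_family:
  assumes "0 \<le> \<eta>" "1 \<le> 2 * real m * \<eta>\<^sup>2"
    and "P \<subseteq> hamming_space d" "finite P" "1 \<le> k" "k \<le> card P"
  shows "\<exists>\<A>. finite \<A> \<and> card \<A> \<le> 3 ^ m * card P ^ (m + 3) \<and>
    (\<forall>A\<in>\<A>. A \<subseteq> P \<and> card A = k) \<and>
    (\<forall>q\<in>hamming_space d. \<exists>A\<in>\<A>. approx_knn_answer (1 + 8 * \<eta>) P k q A)"
proof -
  obtain \<A> where \<A>: "finite \<A>" "card \<A> \<le> card (candidate_sets \<eta> m d P)"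
    "\<forall>A\<in>\<A>. card A = k \<and> (\<exists>C\<in>candidate_sets \<eta> m d P. A \<subseteq> C)"
    "\<forall>C\<in>candidate_sets \<eta> m d P. k \<le> card C \<longrightarrow> (\<exists>A\<in>\<A>. A \<subseteq> C)"
    using refine_family_to_card_subsets[OF finite_candidate_sets[OF assms(4)]] by metis
  have answers: "\<forall>A\<in>\<A>. A \<subseteq> P \<and> card A = k"
    using \<A>(3) candidate_sets_subset by blast
  have "\<exists>A\<in>\<A>. approx_knn_answer (1 + 8 * \<eta>) P k q A" if q: "q \<in> hamming_space d" for q
  proof -
    obtain C where C: "C \<in> candidate_sets \<eta> m d P" "k \<le> card C"
      "\<forall>x\<in>C. real (hamming_dist q x) \<le> (1 + 8 * \<eta>) * real (kth_nn_dist P k q)"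
      using exists_large_candidate_set_near_query[OF assms q] by blast
    then obtain A where A: "A \<in> \<A>" "A \<subseteq> C"
      using \<A>(4) by blast
    then have "approx_knn_answer (1 + 8 * \<eta>) P k q A"
      using answers C(3) by (auto simp: approx_knn_answer_def)
    with A(1) show ?thesis
      by blast
  qed
  moreover have "card \<A> \<le> 3 ^ m * card P ^ (m + 3)"
    using \<A>(2) card_candidate_sets_le[OF assms(4)] by (rule order_trans)
  ultimately show ?thesis
    using \<A>(1) answers by blast
qed

definition answers_approx_knn_queries ::
    "real \<Rightarrow> nat \<Rightarrow> bool list set \<Rightarrow> nat \<Rightarrow> nat \<Rightarrow> bool list set set \<Rightarrow> bool" where
  "answers_approx_knn_queries c d P k B \<B> \<longleftrightarrow>
    (\<forall>q\<in>hamming_space d. \<exists>\<S>\<subseteq>\<B>. int (card \<S>) = \<lceil>real k / real B\<rceil> \<and>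
      (\<exists>A. approx_knn_answer c P k q A \<and> A \<subseteq> \<Union>\<S>))"

lemma approx_knn_indexing_scheme:
  assumes \<eta>: "0 \<le> \<eta>" "1 \<le> 2 * real m * \<eta>\<^sup>2"
    and P: "P \<subseteq> hamming_space d" and k: "1 \<le> k" "k \<le> card P" and B: "1 \<le> B"
  shows "\<exists>\<B>. indexing_scheme P B \<B> \<and>
    real (card \<B>) \<le> 3 ^ m * real (card P) ^ (m + 3) * \<lceil>real k / real B\<rceil> \<and>
    answers_approx_knn_queries (1 + 8 * \<eta>) d P k B \<B>"
proof -
  have finP: "finite P"
    using k by (simp add: card_ge_0_finite)
  obtain \<A> where \<A>: "finite \<A>" "card \<A> \<le> 3 ^ m * card P ^ (m + 3)"
    "\<forall>A\<in>\<A>. A \<subseteq> P \<and> card A = k"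
    "\<forall>q\<in>hamming_space d. \<exists>A\<in>\<A>. approx_knn_answer (1 + 8 * \<eta>) P k q A"
    using approx_knn_answer_family[OF \<eta> P finP k] by metis
  obtain \<B> where \<B>: "indexing_scheme P B \<B>"
    and card_\<B>: "real (card \<B>) \<le> real (card \<A>) * \<lceil>real k / real B\<rceil>"
    and covers: "\<forall>A\<in>\<A>. \<exists>\<S>\<subseteq>\<B>. int (card \<S>) = \<lceil>real k / real B\<rceil> \<and> A \<subseteq> \<Union>\<S>"
    using indexing_scheme_covering_family[OF \<A>(1) _ B, of P k] \<A>(3) finP by (metis finite_subset)
  have "(0::real) \<le> real k / real B"
    by simp
  then have "(0::real) \<le> \<lceil>real k / real B\<rceil>"
    by linarith
  moreover have "real (card \<A>) \<le> 3 ^ m * real (card P) ^ (m + 3)"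
    using of_nat_mono[OF \<A>(2), where 'a = real] by simp
  ultimately have "real (card \<B>) \<le> 3 ^ m * real (card P) ^ (m + 3) * \<lceil>real k / real B\<rceil>"
    using card_\<B> by (meson mult_right_mono order_trans)
  moreover have "answers_approx_knn_queries (1 + 8 * \<eta>) d P k B \<B>"
    unfolding answers_approx_knn_queries_def using \<A>(4) covers by meson
  ultimately show ?thesis
    using \<B> by blast
qed

theorem theorem4:
  fixes c :: real
  assumes "c > 1"
  shows "\<exists>(C::real) (a::nat). \<forall>(d::nat) (n::nat) (k::nat) (B::nat) (P::bool list set).
    1 \<le> d \<and> P \<subseteq> hamming_space d \<and> card P = n \<and> 1 \<le> k \<and> k \<le> n \<and> 1 \<le> B \<longrightarrow>
    (\<exists>\<B>. indexing_scheme P B \<B> \<and>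
       real (card \<B>) \<le> C * (real n ^ a * real d * real_of_int \<lceil>real k / real B\<rceil>) \<and>
       (\<forall>q\<in>hamming_space d. \<exists>\<S>\<subseteq>\<B>.
          int (card \<S>) = \<lceil>real k / real B\<rceil> \<and>
          (\<exists>A. approx_knn_answer c P k q A \<and> A \<subseteq> \<Union>\<S>)))"
proof -
  obtain \<eta> where \<eta>: "0 < \<eta>" "1 + 8 * \<eta> = c"
    using assms that[of "(c - 1) / 8"] by (simp add: field_simps)
  obtain m :: nat where "1 / (2 * \<eta>\<^sup>2) \<le> real m"
    using real_arch_simple by blast
  then have m: "1 \<le> 2 * real m * \<eta>\<^sup>2"
    using \<eta>(1) by (simp add: field_simps)
  show ?thesis
    unfolding answers_approx_knn_queries_def[symmetric]
  proof (intro exI[of _ "3 ^ m :: real"] exI[of _ "m + 3"] allI impI, elim conjE)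
    fix d n k B :: nat and P :: "bool list set"
    let ?blocks = "real_of_int \<lceil>real k / real B\<rceil>"
    assume "1 \<le> d" "P \<subseteq> hamming_space d" "card P = n" "1 \<le> k" "k \<le> n" "1 \<le> B"
    then obtain \<B> where \<B>: "indexing_scheme P B \<B>" "answers_approx_knn_queries c d P k B \<B>"
      and "real (card \<B>) \<le> 3 ^ m * real n ^ (m + 3) * ?blocks"
      using approx_knn_indexing_scheme[OF less_imp_le[OF \<eta>(1)] m] unfolding \<eta>(2) by blast
    then have "real (card \<B>) * 1 \<le> (3 ^ m * real n ^ (m + 3) * ?blocks) * real d"
      using \<open>1 \<le> d\<close> by (intro mult_mono') simp_all
    with \<B> show "\<exists>\<B>. indexing_scheme P B \<B> \<and>
        real (card \<B>) \<le> 3 ^ m * (real n ^ (m + 3) * real d * ?blocks) \<and>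
        answers_approx_knn_queries c d P k B \<B>"
      by (auto simp: mult_ac)
  qed
qed

end
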